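(* There is a set $A\subseteq\omega$ which is $0$-weakly stochastic but not intrinsically small.
   Context: For $B\subseteq\omega$ and $n\geq1$, $\rho_n(B)=\frac{|B\cap\{0,\dots,n-1\}|}{n}$ and $\rho(B)=\lim_n\rho_n(B)$ when it exists. $A$ is intrinsically small if $\rho(\pi(A))=0$ for every computable permutation $\pi$ of $\omega$. A skip sequence is a finite sequence $((d_0,c_0),\dots,(d_{k-1},c_{k-1}))\in(\omega\times\{0,1\})^{<\omega}$ with $d_0<\dots<d_{k-1}$; a skip rule is a total function $f$ from skip sequences to $\omega$ with $f(\sigma)$ greater than the last first coordinate of $\sigma$ for nonempty $\sigma$. Given $f$ and $A$, put $d_0=f(\emptyset)$, $d_n=f(((d_0,A(d_0)),\dots,(d_{n-1},A(d_{n-1}))))$ and $f(A)=\{n:A(d_n)=1\}$. $A$ is $0$-weakly stochastic if $\rho(f(A))=0$ for every computable skip rule $f$. *)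

theory Defs
  imports Complex_Main "HOL-Library.Nat_Bijection"
begin

section \<open>Computable functions\<close>

text \<open>
  Terms for the partial recursive functions and their big-step semantics:
  \<open>evals e xs y\<close> says that the partial function denoted by \<open>e\<close> is defined on the
  argument list \<open>xs\<close> with value \<open>y\<close>. Terms carry no arities; a term applied to a list
  of unsuitable length is either undefined there or ignores the extra arguments.
  The recursion argument of \<open>Prec\<close> and the search variable of \<open>Mu\<close> come first.
\<close>

datatype recf =
    Zero
  | Succ
  | Proj nat
  | Comp recf "recf list"
  | Prec recf recf
  | Mu recf

inductive evals :: "recf \<Rightarrow> nat list \<Rightarrow> nat \<Rightarrow> bool" where
  Zero: "evals Zero xs 0"
| Succ: "evals Succ [x] (Suc x)"
| Proj: "i < length xs \<Longrightarrow> evals (Proj i) xs (xs ! i)"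
| Comp: "list_all2 (\<lambda>g y. evals g xs y) gs ys \<Longrightarrow> evals f ys z \<Longrightarrow> evals (Comp f gs) xs z"
| Prec_0: "evals f xs y \<Longrightarrow> evals (Prec f g) (0 # xs) y"
| Prec_Suc: "evals (Prec f g) (n # xs) r \<Longrightarrow> evals g (n # r # xs) y \<Longrightarrow>
    evals (Prec f g) (Suc n # xs) y"
| Mu: "evals f (n # xs) 0 \<Longrightarrow> (\<And>i. i < n \<Longrightarrow> \<exists>y>0. evals f (i # xs) y) \<Longrightarrow> evals (Mu f) xs n"

inductive_cases evals_ZeroE: "evals Zero xs y"
inductive_cases evals_SuccE: "evals Succ xs y"
inductive_cases evals_ProjE: "evals (Proj i) xs y"
inductive_cases evals_CompE: "evals (Comp f gs) xs y"
inductive_cases evals_Prec_0E: "evals (Prec f g) (0 # xs) y"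
inductive_cases evals_Prec_SucE: "evals (Prec f g) (Suc n # xs) y"
inductive_cases evals_MuE: "evals (Mu f) xs y"

lemma evals_functional: "evals e xs y \<Longrightarrow> evals e xs z \<Longrightarrow> y = z"
proof (induction arbitrary: z rule: evals.induct)
  case (Zero xs)
  then show ?case by (rule evals_ZeroE) simp
next
  case (Succ x)
  then show ?case by (rule evals_SuccE) simp
next
  case (Proj i xs)
  from Proj.prems show ?case by (rule evals_ProjE) simp
next
  case (Comp xs gs ys f w)
  from Comp.prems obtain ys' where ys': "list_all2 (\<lambda>g y. evals g xs y) gs ys'" "evals f ys' z"
    by (rule evals_CompE)
  have "ys = ys'"
    using Comp.IH(1) ys'(1) by (auto simp: list_all2_conv_all_nth intro!: nth_equalityI)
  with Comp.IH(2) ys'(2) show ?case by simp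
next
  case (Prec_0 f xs y g)
  from Prec_0.prems have "evals f xs z" by (rule evals_Prec_0E)
  then show ?case by (rule Prec_0.IH)
next
  case (Prec_Suc f g n xs r y)
  from Prec_Suc.prems obtain r' where r': "evals (Prec f g) (n # xs) r'" "evals g (n # r' # xs) z"
    by (rule evals_Prec_SucE)
  from Prec_Suc.IH(1)[OF r'(1)] r'(2) have "evals g (n # r # xs) z" by simp
  then show ?case by (rule Prec_Suc.IH(2))
next
  case (Mu f n xs)
  from Mu.prems have z: "evals f (z # xs) 0" "\<And>i. i < z \<Longrightarrow> \<exists>y>0. evals f (i # xs) y"
    by (blast elim: evals_MuE)+
  have "\<not> z < n"
  proof
    assume "z < n"
    with Mu.IH(2) obtain y where "y > 0" "\<forall>x. evals f (z # xs) x \<longrightarrow> y = x" by blast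
    with z(1) show False by blast
  qed
  moreover have "\<not> n < z"
  proof
    assume "n < z"
    with z(2) obtain y where "y > 0" "evals f (n # xs) y" by blast
    with Mu.IH(1) show False by blast
  qed
  ultimately show ?case by simp
qed

definition computable :: "(nat \<Rightarrow> nat) \<Rightarrow> bool" where
  "computable g \<longleftrightarrow> (\<exists>e. \<forall>x. evals e [x] (g x))"


section \<open>Asymptotic density and intrinsic smallness\<close>

definition partial_density :: "nat \<Rightarrow> nat set \<Rightarrow> real" where
  "partial_density n B = real (card (B \<inter> {..<n})) / real n"

definition has_density :: "nat set \<Rightarrow> real \<Rightarrow> bool" where
  "has_density B l \<longleftrightarrow> (\<lambda>n. partial_density n B) \<longlonglongrightarrow> l"

definition intrinsically_small :: "nat set \<Rightarrow> bool" where
  "intrinsically_small A \<longleftrightarrow>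
    (\<forall>\<pi> :: nat \<Rightarrow> nat. bij \<pi> \<and> computable \<pi> \<longrightarrow> has_density (\<pi> ` A) 0)"


section \<open>Skip rules and weak stochasticity\<close>

text \<open>
  The bits 0 and 1 are represented by \<open>False\<close> and \<open>True\<close>. A skip rule is represented by a
  function on all lists; its values on lists that are not skip sequences are never used.
\<close>

definition skip_seq :: "(nat \<times> bool) list \<Rightarrow> bool" where
  "skip_seq \<sigma> \<longleftrightarrow> sorted_wrt (<) (map fst \<sigma>)"

definition skip_rule :: "((nat \<times> bool) list \<Rightarrow> nat) \<Rightarrow> bool" where
  "skip_rule f \<longleftrightarrow> (\<forall>\<sigma>. skip_seq \<sigma> \<and> \<sigma> \<noteq> [] \<longrightarrow> fst (last \<sigma>) < f \<sigma>)"

definition skip_code :: "(nat \<times> bool) list \<Rightarrow> nat" where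
  "skip_code \<sigma> = list_encode (map (\<lambda>(d, c). prod_encode (d, of_bool c)) \<sigma>)"

text \<open>
  Skip sequences form a decidable set of codes, so asking for a total computable extension to all
  codes is no restriction.
\<close>

definition computable_skip_rule :: "((nat \<times> bool) list \<Rightarrow> nat) \<Rightarrow> bool" where
  "computable_skip_rule f \<longleftrightarrow>
    skip_rule f \<and> (\<exists>g. computable g \<and> (\<forall>\<sigma>. skip_seq \<sigma> \<longrightarrow> f \<sigma> = g (skip_code \<sigma>)))"

primrec skip_prefix :: "((nat \<times> bool) list \<Rightarrow> nat) \<Rightarrow> nat set \<Rightarrow> nat \<Rightarrow> (nat \<times> bool) list" where
  "skip_prefix f A 0 = []"
| "skip_prefix f A (Suc n) =
    (let \<sigma> = skip_prefix f A n; d = f \<sigma> in \<sigma> @ [(d, d \<in> A)])"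

definition skip_pos :: "((nat \<times> bool) list \<Rightarrow> nat) \<Rightarrow> nat set \<Rightarrow> nat \<Rightarrow> nat" where
  "skip_pos f A n = f (skip_prefix f A n)"

definition skip_apply :: "((nat \<times> bool) list \<Rightarrow> nat) \<Rightarrow> nat set \<Rightarrow> nat set" where
  "skip_apply f A = {n. skip_pos f A n \<in> A}"

definition zero_weakly_stochastic :: "nat set \<Rightarrow> bool" where
  "zero_weakly_stochastic A \<longleftrightarrow>
    (\<forall>f. computable_skip_rule f \<longrightarrow> has_density (skip_apply f A) 0)"

end

theory Submission
  imports Defs "HOL-Library.Countable_Set"
begin

section \<open>A computable permutation that reverses blocks\<close>

text \<open>A skip rule reads positions in increasing order only, whereas a permutation may move
  late points to the front. Cut the numbers into blocks \<open>{b..b * b}\<close> and reverse each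
  block; this is a computable permutation. A set filling half of the last t points of a block, with
  t \<ge> b, becomes dense at the front of the reversed block, while a rule meets these points only
  after passing everything before them in the block.

  \<open>one_step_extension\<close> exploits this against finitely many rules at once. Near the end
  of a huge block lie more groups than rules, each much longer than the next one to its right. By
  the pigeonhole principle some group can be filled so that each rule either reads too little of it
  to matter, and the new elements avoid its reads altogether, or has already read so much of an
  earlier group that its hits are a fraction \<epsilon> of its reads. By \<open>picks_causal\<close>
  these reads can be computed on the old set, before the new elements are chosen.

  \<open>stochastic_for_sequence\<close> iterates this with tolerance 2^-n for the first n rules at
  stage n. For each rule the hits in late stages then sum to an arbitrarily small fraction of its
  reads, while every stage makes the reversed set dense once more. The computable rules are
  countable, so one sequence covers them all.\<close>

lemma evals_ProjI: "i < length xs \<Longrightarrow> y = xs ! i \<Longrightarrow> evals (Proj i) xs y"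
  by (simp add: evals.Proj)

lemma evals_Comp1: "evals g xs y \<Longrightarrow> evals f [y] z \<Longrightarrow> evals (Comp f [g]) xs z"
  by (rule evals.Comp[where ys = "[y]"]) auto

lemma evals_Comp2:
  "evals g xs y \<Longrightarrow> evals g' xs y' \<Longrightarrow> evals f [y, y'] z \<Longrightarrow> evals (Comp f [g, g']) xs z"
  by (rule evals.Comp[where ys = "[y, y']"]) auto

lemma evals_Comp3:
  "evals g xs y \<Longrightarrow> evals g' xs y' \<Longrightarrow> evals g'' xs y'' \<Longrightarrow> evals f [y, y', y''] z \<Longrightarrow>
    evals (Comp f [g, g', g'']) xs z"
  by (rule evals.Comp[where ys = "[y, y', y'']"]) auto

section \<open>Arithmetic by recursive terms\<close>

definition r_add :: recf where
  "r_add = Prec (Proj 0) (Comp Succ [Proj 1])"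

lemma evals_r_add: "evals r_add [m, n] (m + n)"
  unfolding r_add_def
proof (induction m)
  case 0
  show ?case by (auto intro!: evals.Prec_0 evals_ProjI)
next
  case (Suc m)
  have "evals (Comp Succ [Proj 1]) [m, m + n, n] (Suc (m + n))"
    by (auto intro!: evals_Comp1[where y = "m + n"] evals_ProjI evals.Succ)
  from evals.Prec_Suc[OF Suc this] show ?case by simp
qed

definition r_mult :: recf where
  "r_mult = Prec Zero (Comp r_add [Proj 1, Proj 2])"

lemma evals_r_mult: "evals r_mult [m, n] (m * n)"
  unfolding r_mult_def
proof (induction m)
  case 0
  show ?case by (auto intro!: evals.Prec_0 evals.Zero)
next
  case (Suc m)
  have "evals (Comp r_add [Proj 1, Proj 2]) [m, m * n, n] (m * n + n)"
    by (rule evals_Comp2[OF _ _ evals_r_add]) (auto intro!: evals_ProjI)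
  from evals.Prec_Suc[OF Suc this] show ?case by (simp add: add.commute)
qed

definition r_pred :: recf where
  "r_pred = Prec Zero (Proj 0)"

lemma evals_r_pred: "evals r_pred [n] (n - 1)"
  unfolding r_pred_def
proof (induction n)
  case 0
  show ?case by (auto intro!: evals.Prec_0 evals.Zero)
next
  case (Suc n)
  then show ?case by (rule evals.Prec_Suc) (auto intro!: evals_ProjI)
qed

text \<open>The subtrahend comes first, because the recursion runs on it.\<close>

definition r_sub :: recf where
  "r_sub = Prec (Proj 0) (Comp r_pred [Proj 1])"

lemma evals_r_sub: "evals r_sub [m, n] (n - m)"
  unfolding r_sub_def
proof (induction m)
  case 0
  show ?case by (auto intro!: evals.Prec_0 evals_ProjI)
next
  case (Suc m)
  have "evals (Comp r_pred [Proj 1]) [m, n - m, n] (n - m - 1)"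
    by (rule evals_Comp1[OF _ evals_r_pred]) (auto intro!: evals_ProjI)
  from evals.Prec_Suc[OF Suc this] show ?case by simp
qed

definition r_if_zero :: recf where
  "r_if_zero = Prec (Proj 0) (Proj 3)"

lemma evals_r_if_zero: "evals r_if_zero [c, m, n] (if c = 0 then m else n)"
  unfolding r_if_zero_def
proof (induction c)
  case 0
  show ?case by (auto intro!: evals.Prec_0 evals_ProjI)
next
  case (Suc c)
  then show ?case by (rule evals.Prec_Suc) (auto intro!: evals_ProjI)
qed

text \<open>
  A block that starts at \<open>b\<close> is \<open>{b..b * b}\<close>, and \<open>block_start x\<close> is the start of the block that
  contains \<open>x\<close>. Any block ends beyond every fixed multiple of its start, up to finitely many
  exceptions; nothing else about the block lengths matters.
\<close>

primrec block_start :: "nat \<Rightarrow> nat" where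
  "block_start 0 = 0"
| "block_start (Suc x) = (if block_start x * block_start x \<le> x then Suc x else block_start x)"

definition r_block_start :: recf where
  "r_block_start = Prec Zero (Comp r_if_zero
     [Comp r_sub [Proj 0, Comp r_mult [Proj 1, Proj 1]], Comp Succ [Proj 0], Proj 1])"

lemma evals_r_block_start: "evals r_block_start [x] (block_start x)"
  unfolding r_block_start_def
proof (induction x)
  case 0
  show ?case by (auto intro!: evals.Prec_0 evals.Zero)
next
  case (Suc x)
  let ?b = "block_start x"
  have "evals (Comp r_if_zero
     [Comp r_sub [Proj 0, Comp r_mult [Proj 1, Proj 1]], Comp Succ [Proj 0], Proj 1])
     [x, ?b] (if ?b * ?b - x = 0 then Suc x else ?b)"
    by (rule evals_Comp3[OF evals_Comp2[OF _ evals_Comp2[OF _ _ evals_r_mult] evals_r_sub]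
          evals_Comp1[OF _ evals.Succ] _ evals_r_if_zero]) (auto intro!: evals_ProjI)
  from evals.Prec_Suc[OF Suc this] show ?case by (simp split: if_splits)
qed

lemma block_start_le: "block_start x \<le> x"
  by (induction x) auto

lemma le_block_start_square: "x \<le> block_start x * block_start x"
proof (induction x)
  case (Suc x)
  then show ?case using le_square[of "Suc x"] by (simp del: mult_Suc mult_Suc_right)
qed simp

lemma block_start_eqI:
  assumes "block_start b = b" "b \<le> x" "x \<le> b * b"
  shows "block_start x = b"
  using assms(2,3)
proof (induction x rule: dec_induct)
  case base
  show ?case by (rule assms(1))
next
  case (step x)
  from step.prems have "x < b * b" by simp
  moreover from this have "block_start x = b" by (intro step.IH) simp
  ultimately show ?case by simp
qed

lemma block_start_idem: "block_start (block_start x) = block_start x"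
  by (induction x) auto

lemma block_start_unbounded: "\<exists>b\<ge>k. block_start b = b"
proof (induction k)
  case 0
  show ?case by (intro exI[of _ 0]) simp
next
  case (Suc k)
  then obtain b where b: "b \<ge> k" "block_start b = b" by blast
  have "block_start (b * b) = b"
    by (rule block_start_eqI[OF b(2) le_square order_refl])
  then have "block_start (Suc (b * b)) = Suc (b * b)" by simp
  moreover have "Suc k \<le> Suc (b * b)" using b(1) le_square[of b] by linarith
  ultimately show ?case by blast
qed

text \<open>With b the start of the block of x this is the reflection x -> b * b + b - x of
  \<open>{b..b * b}\<close>; the subtraction never truncates.\<close>

definition block_reversal :: "nat \<Rightarrow> nat" where
  "block_reversal x = block_start x * block_start x + block_start x - x"

lemma block_reversal_involution: "block_reversal (block_reversal x) = x"
proof -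
  define b c where "b = block_start x" and "c = b * b"
  have x: "b \<le> x" "x \<le> c"
    using block_start_le[of x] le_block_start_square[of x] by (simp_all add: b_def c_def)
  have r: "block_reversal x = c + b - x"
    by (simp add: block_reversal_def b_def c_def)
  have "block_start (c + b - x) = b"
  proof (rule block_start_eqI)
    show "block_start b = b" by (simp add: b_def block_start_idem)
    show "b \<le> c + b - x" using x by linarith
    show "c + b - x \<le> b * b" using x unfolding c_def[symmetric] by linarith
  qed
  then have "block_reversal (c + b - x) = c + b - (c + b - x)"
    by (simp add: block_reversal_def c_def)
  also have "\<dots> = x" using x by linarith
  finally show ?thesis unfolding r .
qed

lemma bij_block_reversal: "bij block_reversal"
  by (rule o_bij[of block_reversal]) (auto simp: block_reversal_involution)

lemma computable_block_reversal: "computable block_reversal"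
  unfolding computable_def
proof (intro exI allI)
  fix x
  show "evals (Comp r_sub [Proj 0, Comp r_add
      [Comp r_mult [r_block_start, r_block_start], r_block_start]]) [x] (block_reversal x)"
    unfolding block_reversal_def
    by (rule evals_Comp2[OF _ evals_Comp2[OF evals_Comp2[OF evals_r_block_start
          evals_r_block_start evals_r_mult] evals_r_block_start evals_r_add] evals_r_sub])
      (auto intro!: evals_ProjI)
qed


section \<open>Runs of skip rules\<close>

definition picks :: "((nat \<times> bool) list \<Rightarrow> nat) \<Rightarrow> nat set \<Rightarrow> nat set" where
  "picks f A = range (skip_pos f A)"

lemma skip_prefix_Suc:
  "skip_prefix f A (Suc n) = skip_prefix f A n @ [(skip_pos f A n, skip_pos f A n \<in> A)]"
  by (simp add: skip_pos_def Let_def)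

declare skip_prefix.simps(2) [simp del]

lemma skip_seq_skip_prefix:
  assumes "skip_rule f"
  shows "skip_seq (skip_prefix f A n)"
proof (induction n)
  case 0
  show ?case by (simp add: skip_seq_def)
next
  case (Suc n)
  let ?s = "skip_prefix f A n"
  have "fst p < f ?s" if "p \<in> set ?s" for p
  proof -
    have ne: "?s \<noteq> []" using that by auto
    then have "fst (last ?s) < f ?s"
      using assms Suc by (auto simp: skip_rule_def)
    moreover have "fst p \<le> fst (last ?s)"
    proof -
      have "sorted_wrt (<) (map fst (butlast ?s) @ [fst (last ?s)])"
        using Suc ne unfolding skip_seq_def by (metis append_butlast_last_id list.simps(8,9) map_append)
      then have "\<forall>q\<in>set (butlast ?s). fst q < fst (last ?s)"
        by (auto simp: sorted_wrt_append)
      moreover have "p \<in> set (butlast ?s) \<or> p = last ?s"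
        using that ne by (metis append_butlast_last_id rotate1.simps(2) set_ConsD set_rotate1)
      ultimately show ?thesis by auto
    qed
    ultimately show ?thesis by simp
  qed
  then show ?case
    using Suc by (auto simp: skip_prefix_Suc skip_seq_def skip_pos_def sorted_wrt_append)
qed

lemma strict_mono_skip_pos:
  assumes "skip_rule f"
  shows "strict_mono (skip_pos f A)"
proof (simp only: strict_mono_Suc_iff, rule allI)
  fix n
  have "fst (last (skip_prefix f A (Suc n))) < f (skip_prefix f A (Suc n))"
    using assms skip_seq_skip_prefix[OF assms, of A "Suc n"]
    unfolding skip_rule_def by (metis skip_prefix_Suc snoc_eq_iff_butlast)
  then show "skip_pos f A n < skip_pos f A (Suc n)"
    by (simp add: skip_pos_def skip_prefix_Suc)
qed

lemma skip_prefix_cong: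
  assumes "skip_rule f" "\<And>\<sigma>. skip_seq \<sigma> \<Longrightarrow> f \<sigma> = g \<sigma>"
  shows "skip_prefix g A n = skip_prefix f A n"
proof (induction n)
  case (Suc n)
  then show ?case
    using assms(2)[OF skip_seq_skip_prefix[OF assms(1)]] by (simp add: skip_prefix_Suc skip_pos_def)
qed simp

lemma skip_apply_cong:
  assumes "skip_rule f" "\<And>\<sigma>. skip_seq \<sigma> \<Longrightarrow> f \<sigma> = g \<sigma>"
  shows "skip_apply g A = skip_apply f A"
  using assms(2)[OF skip_seq_skip_prefix[OF assms(1)]] skip_prefix_cong[OF assms]
  by (simp add: skip_apply_def skip_pos_def)

text \<open>A run depends on its set only through the answers received. Agreement is therefore asked
  only at positions that the run on \<open>B\<close> reads, so \<open>A\<close> may differ from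
  \<open>B\<close> anywhere else.\<close>

lemma picks_causal:
  assumes f: "skip_rule f" and eq: "\<And>y. y \<in> picks f B \<Longrightarrow> y < d \<Longrightarrow> y \<in> A \<longleftrightarrow> y \<in> B"
  shows "picks f A \<inter> {..<d} = picks f B \<inter> {..<d}"
proof -
  \<comment> \<open>Either run may be the one known to be below \<open>d\<close>; this yields both
    inclusions at the end.\<close>
  have step: "skip_prefix f A n = skip_prefix f B n"
    if "skip_pos f A n < d \<or> skip_pos f B n < d" for n
    using that
  proof (induction n)
    case (Suc n)
    have lt: "skip_pos f A n < d \<or> skip_pos f B n < d"
      using Suc.prems strict_monoD[OF strict_mono_skip_pos[OF f], of n "Suc n"]
      by (meson lessI less_trans)
    then have "skip_prefix f A n = skip_prefix f B n" by (rule Suc.IH)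
    moreover from this have "skip_pos f A n = skip_pos f B n"
      by (simp add: skip_pos_def)
    ultimately show ?case
      using eq[of "skip_pos f B n"] lt by (auto simp: skip_prefix_Suc picks_def)
  qed simp
  have same: "skip_pos f A n = skip_pos f B n"
    if "skip_pos f A n < d \<or> skip_pos f B n < d" for n
    using step[OF that] by (simp add: skip_pos_def)
  show ?thesis
  proof (intro equalityI subsetI)
    fix x assume "x \<in> picks f A \<inter> {..<d}"
    then obtain n where "x = skip_pos f A n" "x < d" by (auto simp: picks_def)
    then show "x \<in> picks f B \<inter> {..<d}" using same[of n] by (simp add: picks_def)
  next
    fix x assume "x \<in> picks f B \<inter> {..<d}"
    then obtain n where "x = skip_pos f B n" "x < d" by (auto simp: picks_def)
    then show "x \<in> picks f A \<inter> {..<d}"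
      using same[of n, symmetric] by (simp add: picks_def)
  qed
qed

lemma picks_below_skip_pos:
  assumes "skip_rule f"
  shows "picks f A \<inter> {..<skip_pos f A n} = skip_pos f A ` {..<n}"
  using strict_mono_less[OF strict_mono_skip_pos[OF assms]] by (auto simp: picks_def)

text \<open>The increasing injection \<open>skip_pos f A\<close> carries the first n indices to the
  picks below \<open>skip_pos f A n\<close>. Density of \<open>skip_apply f A\<close> thus becomes a
  comparison of hits with picks below a common bound.\<close>

lemma card_skip_apply:
  assumes "skip_rule f"
  shows "card (skip_apply f A \<inter> {..<n}) = card (picks f A \<inter> A \<inter> {..<skip_pos f A n})"
proof -
  have inj: "inj (skip_pos f A)"
    using strict_mono_skip_pos[OF assms] by (rule strict_mono_imp_inj_on)
  have "picks f A \<inter> A \<inter> {..<skip_pos f A n} = skip_pos f A ` (skip_apply f A \<inter> {..<n})"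
  proof -
    have "picks f A \<inter> A \<inter> {..<skip_pos f A n} = skip_pos f A ` {..<n} \<inter> A"
      using picks_below_skip_pos[OF assms, of A n] by blast
    then show ?thesis by (auto simp: skip_apply_def)
  qed
  then show ?thesis using inj by (simp add: card_image inj_on_subset)
qed

lemma card_picks_below_skip_pos:
  assumes "skip_rule f"
  shows "card (picks f A \<inter> {..<skip_pos f A n}) = n"
  using strict_mono_imp_inj_on[OF strict_mono_skip_pos[OF assms, of A]]
  by (simp add: picks_below_skip_pos[OF assms] card_image inj_on_subset)


section \<open>The construction\<close>

text \<open>
  Run every rule on \<open>B\<close> itself, so that it sees only zeros from \<open>u\<close> on. Inside a huge block
  take consecutive groups \<open>G N < \<dots> < G 1\<close> of rapidly decreasing size, and call a rule greedy at
  \<open>G j\<close> if it picks more than a fixed small fraction of \<open>G j\<close>. There are more groups than rules,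
  so some \<open>G j\<close> is for no rule its largest greedy group; the new elements are put there. A rule
  with a larger greedy group has already made many more picks than \<open>G j\<close> has elements. The picks
  of the remaining rules leave most of \<open>G j\<close> free, and they never notice elements placed
  outside their picks. The block reversal moves \<open>G j\<close> in front of the larger groups.
\<close>

lemma one_step_extension:
  fixes Fs :: "((nat \<times> bool) list \<Rightarrow> nat) set" and \<epsilon> :: real
  assumes fin: "finite Fs" and rule: "\<And>f. f \<in> Fs \<Longrightarrow> skip_rule f"
    and B: "B \<subseteq> {..<u}" and \<epsilon>: "\<epsilon> > 0"
  obtains u' C where "u < u'" "C \<subseteq> {u..<u'}"
    "\<exists>n>u. n \<le> 4 * card (block_reversal ` C \<inter> {..<n})"
    "\<And>f A v. f \<in> Fs \<Longrightarrow> A \<inter> {..<u'} = B \<union> C \<Longrightarrow>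
      real (card (picks f A \<inter> C \<inter> {..<v})) \<le> \<epsilon> * real (card (picks f A \<inter> {..<v}))"
proof -
  define m where "m = card Fs"
  \<comment> \<open>\<open>q\<close> exceeds 1/\<epsilon>, so a q-th part of the picks is within
    tolerance, and 4m, so that m rules each taking less than a q-th of a length take at most a
    quarter of it together.\<close>
  obtain q :: nat where "max (1 / \<epsilon>) (real (4 * m + 2)) < real q"
    using reals_Archimedean2 by blast
  then have "1 / \<epsilon> < real q" and "real (4 * m + 2) < real q" by auto
  then have q_eps: "1 \<le> \<epsilon> * real q" and q4: "4 * m \<le> q" and q2: "2 \<le> q"
    using \<epsilon> by (auto simp: field_simps simp del: of_nat_add of_nat_mult)
  define R where "R = q * q"
  define N where "N = m + 1"
  have R4: "4 \<le> R" using mult_le_mono[OF q2 q2] by (simp add: R_def)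
  obtain b where b_ge: "Suc (u + R ^ N) \<le> b" and b_start: "block_start b = b"
    using block_start_unbounded by blast
  \<comment> \<open>\<open>e\<close> is one past the end of the block, and \<open>t j\<close> is the
    distance from \<open>e\<close> back to the left end of \<open>G j\<close>, so larger indices lie
    further left. Of the ratio \<open>R\<close>, one factor \<open>q\<close> pays for the greediness
    threshold 1/q and the other for \<epsilon>.\<close>
  define e where "e = b * b + 1"
  define t where "t j = b * R ^ j" for j
  define G where "G j = {e - t j..<e - t (j - 1)}" for j
  have t_mono: "t i \<le> t j" if "i \<le> j" for i j
    using that R4 by (simp add: t_def power_increasing)
  have t_le: "t j + b \<le> e" if "j \<le> N" for j
  proof -
    have "t j + b \<le> t N + b" using t_mono[OF that] by simp
    also have "\<dots> = b * (R ^ N + 1)" by (simp add: t_def algebra_simps)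
    also have "\<dots> \<le> b * b" using b_ge by (intro mult_le_mono2) linarith
    finally show ?thesis by (simp add: e_def)
  qed
  define greedy where "greedy f j \<longleftrightarrow> t j \<le> q * card (picks f B \<inter> G j)" for f j
  \<comment> \<open>The value 0 stands for having no greedy group. The m rules cannot exhaust the m
    + 1 indices.\<close>
  define J where "J f = Max (insert 0 {j \<in> {1..N}. greedy f j})" for f
  have "\<not> {1..N} \<subseteq> J ` Fs"
  proof
    assume "{1..N} \<subseteq> J ` Fs"
    then have "card {1..N} \<le> card (J ` Fs)" using fin by (intro card_mono) auto
    also have "\<dots> \<le> m" unfolding m_def by (rule card_image_le[OF fin])
    finally show False by (simp add: N_def)
  qed
  then obtain j where j: "1 \<le> j" "j \<le> N" and j_notin: "j \<notin> J ` Fs"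
    by (meson atLeastAtMost_iff subsetI)
  have not_greedy: "\<not> greedy f j" if "J f < j" for f
  proof
    assume "greedy f j"
    then have "j \<le> J f" unfolding J_def using j by (intro Max_ge) auto
    with that show False by simp
  qed
  have greedy_J: "greedy f (J f)" "J f \<le> N" if "j < J f" for f
  proof -
    have "J f \<in> insert 0 {j \<in> {1..N}. greedy f j}" unfolding J_def by (rule Max_in) auto
    with that show "greedy f (J f)" "J f \<le> N" by auto
  qed
  define Fs1 where "Fs1 = {f \<in> Fs. J f < j}"
  have fin1: "finite Fs1" and card1: "card Fs1 \<le> m"
    using fin by (auto simp: Fs1_def m_def intro: card_mono)
  define C where "C = G j - (\<Union>f\<in>Fs1. picks f B)"
  have C_sub: "C \<subseteq> G j" by (simp add: C_def)
  have finG: "finite (G j)" by (simp add: G_def)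
  have finC: "finite C" using C_sub finG by (rule finite_subset)

  \<comment> \<open>\<open>G j\<close> has at least three quarters of \<open>t j\<close> points and
    the non-greedy rules take at most one quarter, so \<open>C\<close> keeps half of
    \<open>t j\<close>.\<close>
  have t_Suc: "4 * t (j - 1) \<le> t j"
  proof -
    have "t j = t (j - 1) * R" using j by (cases j) (simp_all add: t_def)
    then show ?thesis using R4 by (simp add: mult.commute)
  qed
  have card_G: "card (G j) = t j - t (j - 1)"
    using t_le[OF j(2)] t_mono[of "j - 1" j] by (simp add: G_def)
  have card_hit: "4 * card (G j \<inter> (\<Union>f\<in>Fs1. picks f B)) \<le> t j"
  proof -
    have "card (G j \<inter> (\<Union>f\<in>Fs1. picks f B)) = card (\<Union>f\<in>Fs1. picks f B \<inter> G j)"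
      by (rule arg_cong[where f = card]) blast
    also have "\<dots> \<le> (\<Sum>f\<in>Fs1. card (picks f B \<inter> G j))"
      by (rule card_UN_le[OF fin1])
    finally have "q * card (G j \<inter> (\<Union>f\<in>Fs1. picks f B)) \<le> (\<Sum>f\<in>Fs1. q * card (picks f B \<inter> G j))"
      by (simp flip: sum_distrib_left)
    also have "\<dots> \<le> (\<Sum>f\<in>Fs1. t j)"
      using not_greedy by (intro sum_mono) (simp add: Fs1_def greedy_def not_le less_imp_le)
    also have "\<dots> \<le> m * t j" using card1 by simp
    finally have "q * (4 * card (G j \<inter> (\<Union>f\<in>Fs1. picks f B))) \<le> (4 * m) * t j" by simp
    also have "\<dots> \<le> q * t j" using q4 by (rule mult_le_mono1)
    finally show ?thesis using q2 by simp
  qed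
  have "card C = card (G j) - card (G j \<inter> (\<Union>f\<in>Fs1. picks f B))"
    unfolding C_def by (rule card_Diff_subset_Int) (simp add: finG)
  with card_G card_hit t_Suc have card_C: "t j \<le> 2 * card C" by linarith

  have C_block: "b \<le> x" "x < e" "e \<le> x + t j" if "x \<in> C" for x
  proof -
    have "x \<in> G j" using that C_sub by blast
    then show "b \<le> x" "x < e" "e \<le> x + t j" using t_le[OF j(2)] by (auto simp: G_def)
  qed
  show thesis
  proof (rule that[of e C])
    show "u < e" using b_ge le_square[of b] unfolding e_def by linarith
    show "C \<subseteq> {u..<e}"
    proof
      fix x assume "x \<in> C"
      with C_block[of x] b_ge show "x \<in> {u..<e}" by simp
    qed
    \<comment> \<open>The reversal sends \<open>C\<close> below b + t j, which is at most 2 t j.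
      Since \<open>C\<close> has at least t j / 2 points, the factor 4 results.\<close>
    have "block_reversal x < b + t j" if "x \<in> C" for x
    proof -
      have "block_start x = b"
        using C_block[OF that] by (intro block_start_eqI[OF b_start]) (simp_all add: e_def)
      then have "block_reversal x = (e + b) - Suc x" by (simp add: block_reversal_def e_def)
      then show ?thesis using C_block[OF that] by linarith
    qed
    then have "block_reversal ` C \<inter> {..<b + t j} = block_reversal ` C" by auto
    moreover have "card (block_reversal ` C) = card C"
      using bij_block_reversal by (intro card_image) (auto simp: bij_def intro: inj_on_subset)
    moreover have "b \<le> t j" using t_mono[of 0 j] by (simp add: t_def)
    ultimately have "b + t j \<le> 4 * card (block_reversal ` C \<inter> {..<b + t j})"
      using card_C by simp
    moreover have "u < b + t j" using b_ge by linarith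
    ultimately show "\<exists>n>u. n \<le> 4 * card (block_reversal ` C \<inter> {..<n})" by blast
  next
    fix f A v
    assume f: "f \<in> Fs" and A: "A \<inter> {..<e} = B \<union> C"
    have A_iff: "x \<in> A \<longleftrightarrow> x \<in> B \<or> x \<in> C" if "x < e" for x
      using A that by blast
    consider "J f < j" | "j < J f" using j_notin f by (metis image_eqI linorder_neqE_nat)
    then show "real (card (picks f A \<inter> C \<inter> {..<v})) \<le> \<epsilon> * real (card (picks f A \<inter> {..<v}))"
    proof cases
      case 1
      then have disj: "picks f B \<inter> C = {}" using f by (auto simp: C_def Fs1_def)
      \<comment> \<open>Below \<open>e\<close> the sets differ only on \<open>C\<close>, which the
        run on \<open>B\<close> avoids.\<close>
      have "picks f A \<inter> {..<e} = picks f B \<inter> {..<e}"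
        using A_iff disj by (intro picks_causal rule f) blast
      then have "picks f A \<inter> C = {}" using disj C_block(2) by blast
      then show ?thesis using \<epsilon> by simp
    next
      case 2
      show ?thesis
      proof (cases "v \<le> e - t j")
        case True
        then have "C \<inter> {..<v} = {}" using C_sub by (auto simp: G_def)
        then have "picks f A \<inter> C \<inter> {..<v} = {}" by blast
        then show ?thesis using \<epsilon> by simp
      next
        case False
        \<comment> \<open>Nothing new lies to the left of \<open>G j\<close>, so \<open>f\<close>
          reads \<open>G (J f)\<close> exactly as on \<open>B\<close>, and \<open>v\<close> is
          already past that group.\<close>
        have "x \<notin> C" if "x < e - t j" for x using that C_block(3)[of x] by auto
        then have "picks f A \<inter> {..<e - t j} = picks f B \<inter> {..<e - t j}"
          using A_iff by (intro picks_causal rule f) auto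
        moreover have "G (J f) \<subseteq> {..<e - t j}"
        proof -
          have "t j \<le> t (J f - 1)" using 2 by (intro t_mono) linarith
          then show ?thesis by (auto simp: G_def)
        qed
        ultimately have "picks f B \<inter> G (J f) \<subseteq> picks f A \<inter> {..<v}"
          using False by auto
        then have "card (picks f B \<inter> G (J f)) \<le> card (picks f A \<inter> {..<v})"
          by (intro card_mono) auto
        then have "t (J f) \<le> q * card (picks f A \<inter> {..<v})"
          using greedy_J(1)[OF 2] unfolding greedy_def by (meson le_trans mult_le_mono2)
        \<comment> \<open>As J f \<ge> j + 1, the length \<open>t (J f)\<close> gains at least one
          factor R = q * q over \<open>t j\<close>.\<close>
        moreover have "q * (q * t j) \<le> t (J f)"
          using t_mono[of "Suc j" "J f"] 2 by (simp add: t_def R_def algebra_simps)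
        ultimately have "q * (q * t j) \<le> q * card (picks f A \<inter> {..<v})" by linarith
        then have picks_ge: "q * t j \<le> card (picks f A \<inter> {..<v})" using q2 by simp
        have "card (picks f A \<inter> C \<inter> {..<v}) \<le> card (G j)"
          using C_sub by (intro card_mono finG) auto
        also have "\<dots> \<le> t j" by (simp add: card_G)
        finally have "real (card (picks f A \<inter> C \<inter> {..<v})) \<le> 1 * real (t j)" by simp
        also have "\<dots> \<le> (\<epsilon> * real q) * real (t j)"
          using q_eps by (intro mult_right_mono) auto
        also have "\<dots> = \<epsilon> * real (q * t j)" by simp
        also have "\<dots> \<le> \<epsilon> * real (card (picks f A \<inter> {..<v}))"
          using picks_ge \<epsilon> by (intro mult_left_mono) (simp_all only: of_nat_le_iff less_imp_le)
        finally show ?thesis .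
      qed
    qed
  qed
qed

section \<open>Criteria for density zero and for its failure\<close>

lemma has_density_zeroI:
  assumes "\<And>\<delta>. \<delta> > 0 \<Longrightarrow> \<exists>K. \<forall>n. real (card (B \<inter> {..<n})) \<le> K + \<delta> * real n"
  shows "has_density B 0"
  unfolding has_density_def
proof (rule LIMSEQ_I)
  fix r :: real assume "r > 0"
  then obtain K where K: "\<And>n. real (card (B \<inter> {..<n})) \<le> K + r / 2 * real n"
    using assms[of "r / 2"] by auto
  \<comment> \<open>Beyond 2K/r the constant contributes less than r/2 to the quotient.\<close>
  obtain n0 :: nat where n0: "max 0 (2 * K / r) < real n0" using reals_Archimedean2 by blast
  have "norm (partial_density n B - 0) < r" if "n \<ge> n0" for n
  proof -
    have n: "real n > 0" "2 * K / r < real n" using n0 that by auto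
    then have "K < r / 2 * real n" using \<open>r > 0\<close> by (simp add: field_simps)
    then have "real (card (B \<inter> {..<n})) < r * real n" using K[of n] by (simp add: field_simps)
    then show ?thesis using n(1) by (simp add: partial_density_def field_simps)
  qed
  then show "\<exists>no. \<forall>n\<ge>no. norm (partial_density n B - 0) < r" by blast
qed

lemma not_has_density_zeroI:
  assumes "\<And>k. \<exists>n>k. n \<le> 4 * card (B \<inter> {..<n})"
  shows "\<not> has_density B 0"
proof
  assume "has_density B 0"
  then obtain k where k: "\<And>n. n \<ge> k \<Longrightarrow> norm (partial_density n B - 0) < 1 / 4"
    unfolding has_density_def using LIMSEQ_D[of _ _ "1 / 4"] by fastforce
  obtain n where n: "n > k" "n \<le> 4 * card (B \<inter> {..<n})" using assms by blast
  then have "real n \<le> 4 * real (card (B \<inter> {..<n}))" by linarith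
  then have "partial_density n B \<ge> 1 / 4" using n(1) by (simp add: partial_density_def field_simps)
  with k[of n] n(1) show False by simp
qed

lemma stochastic_for_sequence:
  fixes F :: "nat \<Rightarrow> (nat \<times> bool) list \<Rightarrow> nat"
  assumes F: "\<And>i. skip_rule (F i)"
  obtains A where "\<And>i. has_density (skip_apply (F i) A) 0" "\<not> intrinsically_small A"
proof -
  \<comment> \<open>A state (B, u) is a set decided below u. The bound is demanded for every
    \<open>A\<close> continuing the new state, so that it survives all later stages.\<close>
  define ext where "ext n p p' \<longleftrightarrow> (let (B, u) = p; (B', u') = p' in
    \<exists>C. u < u' \<and> C \<subseteq> {u..<u'} \<and> B' = B \<union> C \<and>
      (\<exists>k>u. k \<le> 4 * card (block_reversal ` C \<inter> {..<k})) \<and>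
      (\<forall>i<n. \<forall>A v. A \<inter> {..<u'} = B \<union> C \<longrightarrow>
        real (card (picks (F i) A \<inter> C \<inter> {..<v})) \<le> (1/2) ^ n * real (card (picks (F i) A \<inter> {..<v}))))"
    for n :: nat and p p' :: "nat set \<times> nat"
  have "\<exists>s. \<forall>n. fst (s n) \<subseteq> {..<snd (s n)} \<and> ext n (s n) (s (Suc n))"
  proof (rule dependent_nat_choice)
    show "\<exists>p :: nat set \<times> nat. fst p \<subseteq> {..<snd p}"
      by (intro exI[of _ "({}, 0)"]) simp
  next
    fix p :: "nat set \<times> nat" and n
    assume p: "fst p \<subseteq> {..<snd p}"
    have fin: "finite (F ` {..<n})" and rule: "\<And>f. f \<in> F ` {..<n} \<Longrightarrow> skip_rule f"
      and pos: "(0 :: real) < (1/2) ^ n"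
      using F by auto
    show "\<exists>p'. fst p' \<subseteq> {..<snd p'} \<and> ext n p p'"
    proof (rule one_step_extension[OF fin rule p pos])
      fix u' C
      assume u': "snd p < u'" and C_sub: "C \<subseteq> {snd p..<u'}"
        and dense: "\<exists>k>snd p. k \<le> 4 * card (block_reversal ` C \<inter> {..<k})"
        and picks: "\<And>f A v. f \<in> F ` {..<n} \<Longrightarrow> A \<inter> {..<u'} = fst p \<union> C \<Longrightarrow>
          real (card (picks f A \<inter> C \<inter> {..<v})) \<le> (1/2) ^ n * real (card (picks f A \<inter> {..<v}))"
      have "ext n p (fst p \<union> C, u')"
        unfolding ext_def Let_def case_prod_beta fst_conv snd_conv
      proof (intro exI[of _ C] conjI allI impI)
        fix i A v assume "i < n" and A: "A \<inter> {..<u'} = fst p \<union> C"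
        then have "F i \<in> F ` {..<n}" by simp
        then show "real (card (picks (F i) A \<inter> C \<inter> {..<v}))
            \<le> (1/2) ^ n * real (card (picks (F i) A \<inter> {..<v}))"
          using A by (rule picks)
      qed (fact u' C_sub dense refl)+
      moreover have "fst p \<union> C \<subseteq> {..<u'}"
      proof
        fix x assume "x \<in> fst p \<union> C"
        then show "x \<in> {..<u'}" using p C_sub u' by auto
      qed
      ultimately have "fst (fst p \<union> C, u') \<subseteq> {..<snd (fst p \<union> C, u')} \<and> ext n p (fst p \<union> C, u')"
        by (simp only: fst_conv snd_conv simp_thms)
      then show ?thesis by (rule exI)
    qed
  qed
  then obtain s where s: "\<And>n. fst (s n) \<subseteq> {..<snd (s n)}" "\<And>n. ext n (s n) (s (Suc n))"
    by blast
  define B where "B n = fst (s n)" for n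
  define u where "u n = snd (s n)" for n
  define extends where "extends n C \<longleftrightarrow> u n < u (Suc n) \<and> C \<subseteq> {u n..<u (Suc n)} \<and>
      B (Suc n) = B n \<union> C \<and>
      (\<exists>k>u n. k \<le> 4 * card (block_reversal ` C \<inter> {..<k})) \<and>
      (\<forall>i<n. \<forall>A v. A \<inter> {..<u (Suc n)} = B n \<union> C \<longrightarrow>
        real (card (picks (F i) A \<inter> C \<inter> {..<v}))
          \<le> (1/2) ^ n * real (card (picks (F i) A \<inter> {..<v})))" for n C
  have "\<exists>C. extends n C" for n
    using s(2)[of n] unfolding ext_def Let_def case_prod_beta extends_def B_def u_def .
  then obtain C where C: "\<And>n. extends n (C n)" by metis
  have u_less: "u n < u (Suc n)" and C_sub: "C n \<subseteq> {u n..<u (Suc n)}"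
    and B_Suc: "B (Suc n) = B n \<union> C n"
    and C_dense: "\<exists>k>u n. k \<le> 4 * card (block_reversal ` C n \<inter> {..<k})" for n
    using C[of n] by (simp_all only: extends_def)
  have C_picks: "real (card (picks (F i) A \<inter> C n \<inter> {..<v}))
      \<le> (1/2) ^ n * real (card (picks (F i) A \<inter> {..<v}))"
    if "i < n" "A \<inter> {..<u (Suc n)} = B n \<union> C n" for n i A v
    using C[of n] that unfolding extends_def by blast
  have B_sub: "B n \<subseteq> {..<u n}" for n using s(1) by (simp add: B_def u_def)
  have n_le_u: "n \<le> u n" for n
    by (rule seq_suble) (simp add: strict_mono_Suc_iff u_less)
  have u_mono: "u i \<le> u j" if "i \<le> j" for i j
    by (rule lift_Suc_mono_le[of u, OF less_imp_le[OF u_less] that])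
  have "B n \<subseteq> B (Suc n)" for n unfolding B_Suc by blast
  then have B_mono: "B i \<subseteq> B j" if "i \<le> j" for i j
    using that by (rule lift_Suc_mono_le[of B])
  have B_below: "B j \<inter> {..<u i} = B i" if "i \<le> j" for i j
    using that
  proof (induction j rule: dec_induct)
    case base
    show ?case using B_sub[of i] by blast
  next
    case (step j)
    have "C j \<inter> {..<u i} = {}" using C_sub[of j] u_mono[OF step.hyps(1)] by fastforce
    with step.IH B_Suc show ?case by blast
  qed
  define A where "A = (\<Union>n. B n)"
  have A_below: "A \<inter> {..<u i} = B i" for i
  proof
    show "A \<inter> {..<u i} \<subseteq> B i"
    proof
      fix x assume "x \<in> A \<inter> {..<u i}"
      then obtain j where "x \<in> B j" "x < u i" by (auto simp: A_def)
      then have "x \<in> B (max i j) \<inter> {..<u i}" using B_mono[of j "max i j"] by auto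
      then show "x \<in> B i" using B_below[of i "max i j"] by simp
    qed
    show "B i \<subseteq> A \<inter> {..<u i}" using B_sub[of i] by (auto simp: A_def)
  qed
  have C_sub_A: "C n \<subseteq> A" for n using B_Suc[of n] by (auto simp: A_def)

  have "has_density (skip_apply (F i) A) 0" for i
  proof (rule has_density_zeroI)
    fix \<delta> :: real assume "\<delta> > 0"
    \<comment> \<open>From stage \<open>M\<close> on, rule i is among those treated, and the
      tolerances sum to at most 2 * 2^-M.\<close>
    then obtain M0 where "(1/2) ^ M0 < \<delta> / 2"
      using real_arch_pow_inv[of "\<delta> / 2" "1/2"] by auto
    moreover define M where "M = max M0 (Suc i)"
    moreover have "(1/2 :: real) ^ M \<le> (1/2) ^ M0"
      unfolding M_def by (rule power_decreasing) auto
    ultimately have M: "2 * (1/2) ^ M < \<delta>" by linarith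
    have Mi: "i < M" by (simp add: M_def)
    have fin: "finite (B n)" for n using B_sub by (rule finite_subset) simp
    \<comment> \<open>The coefficient is the geometric sum of 2^-k for M \<le> k < n; the finite set
      \<open>B M\<close> absorbs the earlier stages.\<close>
    have bound: "real (card (picks (F i) A \<inter> B n \<inter> {..<v}))
        \<le> real (card (B M)) + (2 * (1/2) ^ M - 2 * (1/2) ^ n) * real (card (picks (F i) A \<inter> {..<v}))"
      if "M \<le> n" for n v
      using that
    proof (induction n rule: dec_induct)
      case base
      have "card (picks (F i) A \<inter> B M \<inter> {..<v}) \<le> card (B M)"
        by (rule card_mono[OF fin]) blast
      then show ?case by simp
    next
      case (step n)
      have "picks (F i) A \<inter> B (Suc n) \<inter> {..<v}
          = (picks (F i) A \<inter> B n \<inter> {..<v}) \<union> (picks (F i) A \<inter> C n \<inter> {..<v})"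
        unfolding B_Suc by blast
      then have "card (picks (F i) A \<inter> B (Suc n) \<inter> {..<v})
          \<le> card (picks (F i) A \<inter> B n \<inter> {..<v}) + card (picks (F i) A \<inter> C n \<inter> {..<v})"
        by (simp only: card_Un_le)
      moreover have "real (card (picks (F i) A \<inter> C n \<inter> {..<v}))
          \<le> (1/2) ^ n * real (card (picks (F i) A \<inter> {..<v}))"
      proof (rule C_picks)
        show "i < n" using step.hyps(1) Mi by linarith
        show "A \<inter> {..<u (Suc n)} = B n \<union> C n" unfolding A_below B_Suc ..
      qed
      ultimately show ?case using step.IH by (simp add: algebra_simps)
    qed
    show "\<exists>K. \<forall>n. real (card (skip_apply (F i) A \<inter> {..<n})) \<le> K + \<delta> * real n"
    proof (intro exI allI)
      fix n
      define v where "v = skip_pos (F i) A n"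
      \<comment> \<open>Because n \<le> u n, stage \<open>max M v\<close> has already settled
        \<open>A\<close> below \<open>v\<close>.\<close>
      have "{..<v} \<subseteq> {..<u (max M v)}" using n_le_u[of "max M v"] by simp
      then have "A \<inter> {..<v} = A \<inter> {..<u (max M v)} \<inter> {..<v}"
        by (simp only: Int_assoc Int_absorb1)
      also have "\<dots> = B (max M v) \<inter> {..<v}" by (simp only: A_below)
      finally have "picks (F i) A \<inter> A \<inter> {..<v} = picks (F i) A \<inter> B (max M v) \<inter> {..<v}"
        by (simp only: Int_assoc)
      then have "real (card (skip_apply (F i) A \<inter> {..<n}))
          = real (card (picks (F i) A \<inter> B (max M v) \<inter> {..<v}))"
        by (simp only: card_skip_apply[OF F] flip: v_def)
      also have "\<dots> \<le> real (card (B M)) + (2 * (1/2) ^ M - 2 * (1/2) ^ max M v) * real n"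
        using bound[of "max M v" v] card_picks_below_skip_pos[OF F, of i A n] by (simp add: v_def)
      also have "\<dots> \<le> real (card (B M)) + \<delta> * real n"
      proof (intro add_left_mono mult_right_mono)
        have "0 \<le> (1/2 :: real) ^ max M v" by simp
        with M show "2 * (1/2) ^ M - 2 * (1/2) ^ max M v \<le> \<delta>" by linarith
      qed simp
      finally show "real (card (skip_apply (F i) A \<inter> {..<n})) \<le> real (card (B M)) + \<delta> * real n" .
    qed
  qed
  moreover have "\<not> has_density (block_reversal ` A) 0"
  proof (rule not_has_density_zeroI)
    fix k
    obtain n where n: "n > u k" "n \<le> 4 * card (block_reversal ` C k \<inter> {..<n})"
      using C_dense by blast
    have "card (block_reversal ` C k \<inter> {..<n}) \<le> card (block_reversal ` A \<inter> {..<n})"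
      using C_sub_A by (intro card_mono) auto
    with n n_le_u[of k] show "\<exists>n>k. n \<le> 4 * card (block_reversal ` A \<inter> {..<n})"
      by (intro exI[of _ n]) linarith
  qed
  then have "\<not> intrinsically_small A"
    using bij_block_reversal computable_block_reversal by (auto simp: intrinsically_small_def)
  ultimately show thesis by (rule that)
qed

section \<open>Countability and the passage to all computable rules\<close>

instance recf :: countable
  by countable_datatype

text \<open>Evaluation is functional, so a term determines the function that it computes.\<close>

lemma countable_computable: "countable {g. computable g}"
proof (rule countable_subset)
  show "{g. computable g} \<subseteq> range (\<lambda>e x. THE y. evals e [x] y)"
  proof
    fix g :: "nat \<Rightarrow> nat" assume "g \<in> {g. computable g}"
    then obtain e where e: "\<And>x. evals e [x] (g x)" by (auto simp: computable_def)
    have "(THE y. evals e [x] y) = g x" for x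
      using e evals_functional by (intro the_equality) blast+
    then show "g \<in> range (\<lambda>e x. THE y. evals e [x] y)" by (intro image_eqI[of _ _ e]) auto
  qed
qed simp

theorem theorem4:
  "\<exists>A :: nat set. zero_weakly_stochastic A \<and> \<not> intrinsically_small A"
proof -
  \<comment> \<open>A concrete skip rule that makes \<open>S\<close> nonempty, so that
    \<open>from_nat_into S\<close> enumerates exactly \<open>S\<close>.\<close>
  define f0 :: "(nat \<times> bool) list \<Rightarrow> nat" where "f0 \<sigma> = Suc (fst (last \<sigma>))" for \<sigma>
  \<comment> \<open>Two rules that agree on skip sequences have the same runs, so it suffices to treat the
    rules that factor through \<open>skip_code\<close>; there are only countably many.\<close>
  define S where "S = insert f0 {f. skip_rule f \<and> f \<in> (\<lambda>g \<sigma>. g (skip_code \<sigma>)) ` {g. computable g}}"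
  have S_rule: "skip_rule f" if "f \<in> S" for f
    using that by (auto simp: S_def f0_def skip_rule_def)
  have "S \<subseteq> insert f0 ((\<lambda>g \<sigma>. g (skip_code \<sigma>)) ` {g. computable g})"
    by (auto simp: S_def)
  then have "countable S"
    by (rule countable_subset) (intro countable_insert countable_image countable_computable)
  moreover have "S \<noteq> {}" by (simp add: S_def)
  ultimately have S_range: "range (from_nat_into S) = S" by simp
  then obtain A where A: "\<And>i. has_density (skip_apply (from_nat_into S i) A) 0"
    and not_small: "\<not> intrinsically_small A"
    using S_rule stochastic_for_sequence[of "from_nat_into S"] by (metis rangeI)
  have "has_density (skip_apply f A) 0" if "computable_skip_rule f" for f
  proof -
    from that obtain g where f: "skip_rule f" and g: "computable g"
      and eq: "\<And>\<sigma>. skip_seq \<sigma> \<Longrightarrow> f \<sigma> = g (skip_code \<sigma>)"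
      by (auto simp: computable_skip_rule_def)
    have "skip_rule (\<lambda>\<sigma>. g (skip_code \<sigma>))" using f eq by (simp add: skip_rule_def)
    with g have "(\<lambda>\<sigma>. g (skip_code \<sigma>)) \<in> S" by (auto simp: S_def)
    with S_range obtain i where "from_nat_into S i = (\<lambda>\<sigma>. g (skip_code \<sigma>))" by (metis imageE)
    then have "has_density (skip_apply (\<lambda>\<sigma>. g (skip_code \<sigma>)) A) 0" using A[of i] by simp
    then show ?thesis using skip_apply_cong[OF f eq] by simp
  qed
  with not_small show ?thesis by (auto simp: zero_weakly_stochastic_def)
qed

end
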